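(* Fix $(s_0,b_0,b_1,s_1)\in\Theta$. Let $\{\kappa_n\}_{n=1}^\infty\subset\mathcal K$ and $\kappa\in\mathcal K$ be such that $\lim_{n\to\infty}\|\kappa_n-\kappa\|_1=0$. For each $n$ let $\Upsilon_n:L^1\to L^1$ be the RealLife Euclidean automaton defined by $(s_0,b_0,b_1,s_1)$ and $\kappa_n$, and let $\Upsilon$ be the one defined by $(s_0,b_0,b_1,s_1)$ and $\kappa$. Let ${}^0\!\mathcal A^{\mathbb R^D}$ be defined using $(s_0,b_0,b_1,s_1)$ and $\kappa$. Then: (a) $\lim_{n\to\infty}\|\Upsilon_n(\mathbf a)-\Upsilon(\mathbf a)\|_1=0$ for all $\mathbf a\in{}^0\!\mathcal A^{\mathbb R^D}$. (b) If $\sup_{n}\|\kappa_n\|_\infty<\infty$, then $\{\Upsilon_n\}_{n=1}^\infty$ evolves to $\Upsilon$ on ${}^0\!\mathcal A^{\mathbb R^D}$.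
   Context: Let $D\ge 1$, let $\lambda$ be Lebesgue measure on $\mathbb R^D$, $L^1=L^1(\mathbb R^D,\lambda)$. $\mathcal A^{\mathbb R^D}$ is the set of Borel-measurable functions $\mathbf a:\mathbb R^D\to\{0,1\}$; ${}^1\!\mathcal A^{\mathbb R^D}=\mathcal A^{\mathbb R^D}\cap L^1$. $\mathcal K$ is the set of $\kappa\in L^\infty(\mathbb R^D;[0,\infty))$ with compact support and $\int\kappa\,d\lambda=1$; $(\kappa*\mathbf a)(x)=\int\kappa(y)\mathbf a(x-y)\,d\lambda(y)$. $\Theta=\{(s_0,b_0,b_1,s_1): 0<s_0\le b_0<b_1\le s_1\le 1\}$. The RealLife Euclidean automaton defined by $(s_0,b_0,b_1,s_1)\in\Theta$ and $\kappa\in\mathcal K$ is the map $\Upsilon:L^1\to L^1$, $$\Upsilon(\mathbf a)(x)=\mathbf a(x)\,\mathbf 1_{[s_0,s_1]}(\kappa*\mathbf a(x))+(1-\mathbf a(x))\,\mathbf 1_{[b_0,b_1]}(\kappa*\mathbf a(x)).$$ ${}^0\!\mathcal A^{\mathbb R^D}=\{\mathbf a\in{}^1\!\mathcal A^{\mathbb R^D}: \lambda\{x:\kappa*\mathbf a(x)\in\{s_0,b_0,b_1,s_1\}\}=0\}$. Shifts: $\sigma^v(\mathbf a)(x)=\mathbf a(x+v)$, $v\in\mathbb R^D$. Evolution: let $\Phi,\Phi_n:L^1\to L^1$ ($n\in\mathbb N$) commute with all shifts, and let $\mathfrak A\subset L^1$ be shift-invariant. $\{\Phi_n\}$ evolves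 to $\Phi$ on $\mathfrak A$ if, for every sequence $\{\mathbf a_n\}\subset L^1$ converging in $L^1$ to some $\mathbf a\in\mathfrak A$: (1) if $\Phi_n(\mathbf a_n)=\mathbf a_n$ for all $n$, then $\Phi(\mathbf a)=\mathbf a$; (2) for every $P\in\mathbb N$ such that $\Phi^p(\mathbf a)\in\mathfrak A$ for all $0\le p<P$: [i] if $\Phi_n^P(\mathbf a_n)=\mathbf a_n$ for all $n$, then $\Phi^P(\mathbf a)=\mathbf a$; [ii] if $v_n\to v$ in $\mathbb R^D$ and $\Phi_n^P(\mathbf a_n)=\sigma^{Pv_n}(\mathbf a_n)$ for all $n$, then $\Phi^P(\mathbf a)=\sigma^{Pv}(\mathbf a)$. *)

theory Defs
  imports "HOL-Probability.Essential_Supremum"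
begin

text \<open>
  Elements of \<open>L\<^sup>1\<close> and \<open>L\<^sup>\<infinity>\<close> are represented by Borel functions. Equality of elements is equality
  almost everywhere (\<open>AE_eq\<close>), and a set of functions stands for the set of its \<open>AE_eq\<close>-classes.
  The type \<open>real ^ 'd\<close> is Euclidean space of dimension \<open>CARD('d) \<ge> 1\<close>.
\<close>

type_synonym 'd field = "real ^ 'd \<Rightarrow> real"

definition L1 :: "'d::finite field set" where
  "L1 = {f. integrable lborel f}"

definition AE_eq :: "'d::finite field \<Rightarrow> 'd field \<Rightarrow> bool" (infix "\<doteq>" 50) where
  "f \<doteq> g \<longleftrightarrow> (AE x in lborel. f x = g x)"

definition class_in :: "'d::finite field \<Rightarrow> 'd field set \<Rightarrow> bool" where
  "class_in f S \<longleftrightarrow> (\<exists>g\<in>S. f \<doteq> g)"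

text \<open>The norms are extended-valued, so a function with infinite norm gets norm \<open>\<infinity>\<close> rather than
  the default value \<open>0\<close> of the Bochner integral.\<close>

definition L1_norm :: "'d::finite field \<Rightarrow> ennreal" where
  "L1_norm f = (\<integral>\<^sup>+x. ennreal \<bar>f x\<bar> \<partial>lborel)"

definition Linf_norm :: "'d::finite field \<Rightarrow> ennreal" where
  "Linf_norm f = esssup lborel (\<lambda>x. ennreal \<bar>f x\<bar>)"

definition L1_converges :: "(nat \<Rightarrow> 'd::finite field) \<Rightarrow> 'd field \<Rightarrow> bool" where
  "L1_converges F f \<longleftrightarrow> (\<lambda>n. L1_norm (\<lambda>x. F n x - f x)) \<longlonglongrightarrow> 0"

definition configs :: "'d::finite field set" where
  "configs = {a \<in> borel_measurable borel. \<forall>x. a x \<in> {0, 1}}"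

definition configs1 :: "'d::finite field set" where
  "configs1 = configs \<inter> L1"

definition kernels :: "'d::finite field set" where
  "kernels = {\<kappa> \<in> borel_measurable borel.
     (AE x in lborel. 0 \<le> \<kappa> x) \<and> Linf_norm \<kappa> < \<infinity> \<and>
     (\<exists>K. compact K \<and> (AE x in lborel. x \<notin> K \<longrightarrow> \<kappa> x = 0)) \<and>
     (\<integral>x. \<kappa> x \<partial>lborel) = 1}"

definition conv :: "'d::finite field \<Rightarrow> 'd field \<Rightarrow> 'd field" where
  "conv \<kappa> a x = (\<integral>y. \<kappa> y * a (x - y) \<partial>lborel)"

definition Theta :: "(real \<times> real \<times> real \<times> real) set" where
  "Theta = {(s0, b0, b1, s1). 0 < s0 \<and> s0 \<le> b0 \<and> b0 < b1 \<and> b1 \<le> s1 \<and> s1 \<le> 1}"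

fun RealLife :: "real \<times> real \<times> real \<times> real \<Rightarrow> 'd::finite field \<Rightarrow> 'd field \<Rightarrow> 'd field" where
  "RealLife (s0, b0, b1, s1) \<kappa> a =
     (\<lambda>x. a x * indicator {s0..s1} (conv \<kappa> a x) + (1 - a x) * indicator {b0..b1} (conv \<kappa> a x))"

fun configs0 :: "real \<times> real \<times> real \<times> real \<Rightarrow> 'd::finite field \<Rightarrow> 'd field set" where
  "configs0 (s0, b0, b1, s1) \<kappa> =
     {a \<in> configs1. {x. conv \<kappa> a x \<in> {s0, b0, b1, s1}} \<in> null_sets lborel}"

definition shift :: "real ^ 'd::finite \<Rightarrow> 'd field \<Rightarrow> 'd field" where
  "shift v a = (\<lambda>x. a (x + v))"

text \<open>\<open>\<Phi>\<close> induces a map \<open>L\<^sup>1 \<rightarrow> L\<^sup>1\<close>, i.e. it also respects equality almost everywhere.\<close>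

definition L1_map :: "('d::finite field \<Rightarrow> 'd field) \<Rightarrow> bool" where
  "L1_map \<Phi> \<longleftrightarrow> (\<forall>f\<in>L1. \<Phi> f \<in> L1) \<and> (\<forall>f\<in>L1. \<forall>g\<in>L1. f \<doteq> g \<longrightarrow> \<Phi> f \<doteq> \<Phi> g)"

definition shift_commuting :: "('d::finite field \<Rightarrow> 'd field) \<Rightarrow> bool" where
  "shift_commuting \<Phi> \<longleftrightarrow> (\<forall>v. \<forall>f\<in>L1. \<Phi> (shift v f) \<doteq> shift v (\<Phi> f))"

definition shift_invariant :: "'d::finite field set \<Rightarrow> bool" where
  "shift_invariant S \<longleftrightarrow> (\<forall>v. \<forall>f\<in>S. class_in (shift v f) S)"

text \<open>The standing requirements under which evolution is defined (shift-commuting maps of \<open>L\<^sup>1\<close>,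
  a shift-invariant subset of \<open>L\<^sup>1\<close>) are part of the predicate.\<close>

definition evolves_to ::
  "(nat \<Rightarrow> 'd::finite field \<Rightarrow> 'd field) \<Rightarrow> ('d field \<Rightarrow> 'd field) \<Rightarrow> 'd field set \<Rightarrow> bool" where
  "evolves_to \<Phi>s \<Phi> S \<longleftrightarrow>
     L1_map \<Phi> \<and> shift_commuting \<Phi> \<and>
     (\<forall>n. L1_map (\<Phi>s n) \<and> shift_commuting (\<Phi>s n)) \<and>
     S \<subseteq> L1 \<and> shift_invariant S \<and>
     (\<forall>as a. (\<forall>n. as n \<in> L1) \<longrightarrow> a \<in> L1 \<longrightarrow> class_in a S \<longrightarrow> L1_converges as a \<longrightarrow>
        ((\<forall>n. \<Phi>s n (as n) \<doteq> as n) \<longrightarrow> \<Phi> a \<doteq> a) \<and>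
        (\<forall>P::nat. (\<forall>p<P. class_in ((\<Phi> ^^ p) a) S) \<longrightarrow>
           ((\<forall>n. (\<Phi>s n ^^ P) (as n) \<doteq> as n) \<longrightarrow> (\<Phi> ^^ P) a \<doteq> a) \<and>
           (\<forall>vs v. vs \<longlonglongrightarrow> v \<longrightarrow>
              (\<forall>n. (\<Phi>s n ^^ P) (as n) \<doteq> shift (real P *\<^sub>R vs n) (as n)) \<longrightarrow>
              (\<Phi> ^^ P) a \<doteq> shift (real P *\<^sub>R v) a)))"

end

theory Submission
  imports Defs
begin

text \<open>
  If \<open>\<kappa>\<^sub>n\<close> tends to \<open>\<kappa>\<close> in \<open>L\<^sup>1\<close> and \<open>a\<^sub>n\<close> tends to a \<open>{0,1}\<close>-valued \<open>a\<close> in \<open>L\<^sup>1\<close>, then \<open>\<kappa>\<^sub>n * a\<^sub>n\<close> tends to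
  \<open>\<kappa> * a\<close> uniformly, provided that \<open>a\<^sub>n = a\<close> or the \<open>\<kappa>\<^sub>n\<close> are uniformly bounded. Off the null set where
  \<open>\<kappa> * a\<close> is a threshold, the birth and survival indicators then converge pointwise. For large \<open>n\<close>
  their differences are dominated by the indicator of \<open>{\<kappa> * a \<ge> l/2}\<close> for a threshold \<open>l > 0\<close>, which has
  finite measure because \<open>\<kappa> * a\<close> is integrable. Hence \<open>\<Upsilon>\<^sub>n(a\<^sub>n)\<close> tends to \<open>\<Upsilon>(a)\<close>, and evolution follows
  by iterating and comparing limits.
\<close>

section \<open>Translation and reflection invariance of Lebesgue measure\<close>

lemma nn_integral_lborel_translate:
  fixes h :: "'a::euclidean_space \<Rightarrow> ennreal"
  assumes [measurable]: "h \<in> borel_measurable borel"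
  shows "(\<integral>\<^sup>+x. h (x + v) \<partial>lborel) = (\<integral>\<^sup>+x. h x \<partial>lborel)"
proof -
  have "(\<integral>\<^sup>+x. h x \<partial>lborel) = (\<integral>\<^sup>+x. h x \<partial>distr lborel borel ((+) v))"
    by (simp add: lborel_distr_plus)
  also have "\<dots> = (\<integral>\<^sup>+x. h (x + v) \<partial>lborel)"
    by (subst nn_integral_distr) (auto simp: add.commute)
  finally show ?thesis by simp
qed

text \<open>The map \<open>y \<mapsto> x - y\<close> is affine with scale -1, so its Jacobian factor
  is a power of 1 in every dimension.\<close>

lemma nn_integral_lborel_reflect:
  fixes h :: "'a::euclidean_space \<Rightarrow> ennreal"
  assumes [measurable]: "h \<in> borel_measurable borel"
  shows "(\<integral>\<^sup>+y. h (x - y) \<partial>lborel) = (\<integral>\<^sup>+y. h y \<partial>lborel)"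
proof -
  have "(\<integral>\<^sup>+y. h y \<partial>lborel) =
      (\<integral>\<^sup>+y. h y \<partial>density (distr lborel borel (\<lambda>y. x + (-1) *\<^sub>R y)) (\<lambda>_. ennreal (\<bar>-1\<bar> ^ DIM('a))))"
    by (subst lborel_affine[of "-1" x]) auto
  also have "\<dots> = (\<integral>\<^sup>+y. h (x - y) \<partial>lborel)"
    by (simp add: density_1 nn_integral_distr)
  finally show ?thesis by simp
qed

lemma integrable_lborel_reflect:
  fixes f :: "'a::euclidean_space \<Rightarrow> real"
  assumes "integrable lborel f"
  shows "integrable lborel (\<lambda>y. f (x - y))"
proof -
  have [measurable]: "f \<in> borel_measurable borel"
    using assms by auto
  have "(\<integral>\<^sup>+y. ennreal (norm (f (x - y))) \<partial>lborel) = (\<integral>\<^sup>+y. ennreal (norm (f y)) \<partial>lborel)"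
    by (rule nn_integral_lborel_reflect[where h = "\<lambda>y. ennreal (norm (f y))"]) simp
  then show ?thesis
    using assms by (auto simp: integrable_iff_bounded)
qed

lemma integrable_lborel_translate:
  fixes f :: "'a::euclidean_space \<Rightarrow> real"
  assumes "integrable lborel f"
  shows "integrable lborel (\<lambda>x. f (x + v))"
proof -
  have [measurable]: "f \<in> borel_measurable borel"
    using assms by auto
  have "(\<integral>\<^sup>+x. ennreal (norm (f (x + v))) \<partial>lborel) = (\<integral>\<^sup>+x. ennreal (norm (f x)) \<partial>lborel)"
    by (rule nn_integral_lborel_translate[where h = "\<lambda>y. ennreal (norm (f y))"]) simp
  then show ?thesis
    using assms by (auto simp: integrable_iff_bounded)
qed

lemma integral_lborel_translate:
  fixes f :: "'a::euclidean_space \<Rightarrow> real"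
  assumes [measurable]: "f \<in> borel_measurable borel"
  shows "(\<integral>x. f (x + v) \<partial>lborel) = (\<integral>x. f x \<partial>lborel)"
proof -
  have "(\<integral>x. f x \<partial>lborel) = (\<integral>x. f x \<partial>distr lborel borel ((+) v))"
    by (simp add: lborel_distr_plus)
  also have "\<dots> = (\<integral>x. f (x + v) \<partial>lborel)"
    by (subst integral_distr) (auto simp: add.commute)
  finally show ?thesis by simp
qed

lemma AE_lborel_translate:
  fixes v :: "'a::euclidean_space"
  assumes "AE x in lborel. P x"
  shows "AE x in lborel. P (x + v)"
proof -
  have "AE x in distr lborel borel ((+) v). P x"
    unfolding lborel_distr_plus by (rule assms)
  then have "AE x in lborel. P (v + x)"
    by (rule AE_distrD[rotated]) simp
  then show ?thesis by (simp add: add.commute)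
qed

lemma AE_lborel_reflect:
  fixes x :: "'a::euclidean_space"
  assumes "AE y in lborel. P y"
  shows "AE y in lborel. P (x - y)"
proof -
  have "lborel = distr lborel borel (\<lambda>y. x + (-1) *\<^sub>R y)"
    by (subst lborel_affine[of "-1" x]) (auto simp: density_1)
  then have "AE y in distr lborel borel (\<lambda>y. x + (-1) *\<^sub>R y). P y"
    using assms by metis
  then have "AE y in lborel. P (x + (-1) *\<^sub>R y)"
    by (rule AE_distrD[rotated]) simp
  then show ?thesis by simp
qed

section \<open>Separating integrable functions by boxes\<close>

text \<open>The positive and the negative part of \<open>f - g\<close> serve as densities of two
  finite measures. These agree on the boxes, an intersection-stable generator of the Borel sets,
  hence everywhere, and a finite density is determined almost everywhere by its measure.\<close>

lemma AE_eq_if_box_integrals_eq: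
  fixes f g :: "'a::euclidean_space \<Rightarrow> real"
  assumes f: "integrable lborel f" and g: "integrable lborel g"
    and eq: "\<And>a b. (\<integral>x. indicator (box a b) x * f x \<partial>lborel) =
      (\<integral>x. indicator (box a b) x * g x \<partial>lborel)"
  shows "AE x in lborel. f x = g x"
proof -
  define d where "d x = f x - g x" for x
  have d: "integrable lborel d"
    unfolding d_def using f g by simp
  then have [measurable]: "d \<in> borel_measurable borel"
    by auto
  have fin: "(\<integral>\<^sup>+x. ennreal (d x) \<partial>lborel) < \<infinity>" "(\<integral>\<^sup>+x. ennreal (- d x) \<partial>lborel) < \<infinity>"
    using d by (auto simp: real_integrable_def top.not_eq_extremum)
  have box: "emeasure (density lborel (\<lambda>x. ennreal (d x))) (box a b) =
      emeasure (density lborel (\<lambda>x. ennreal (- d x))) (box a b)" for a b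
  proof -
    let ?i = "indicator (box a b) :: 'a \<Rightarrow> real"
    have i: "integrable lborel (\<lambda>x. ?i x * h x)" if "integrable lborel h" for h
      using integrable_mult_indicator[of "box a b" lborel h] that by simp
    have "(\<integral>x. ?i x * d x \<partial>lborel) = (\<integral>x. ?i x * f x \<partial>lborel) - (\<integral>x. ?i x * g x \<partial>lborel)"
      unfolding d_def by (subst Bochner_Integration.integral_diff[symmetric])
        (auto simp: i f g right_diff_distrib)
    then have "(\<integral>x. ?i x * d x \<partial>lborel) = 0"
      using eq by simp
    moreover have id: "integrable lborel (\<lambda>x. ?i x * d x)"
      by (rule i[OF d])
    moreover from id have fin_id: "(\<integral>\<^sup>+x. ennreal (?i x * d x) \<partial>lborel) < top"
        "(\<integral>\<^sup>+x. ennreal (- (?i x * d x)) \<partial>lborel) < top"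
      unfolding real_integrable_def by (auto simp: top.not_eq_extremum)
    ultimately have "enn2real (\<integral>\<^sup>+x. ennreal (?i x * d x) \<partial>lborel) =
        enn2real (\<integral>\<^sup>+x. ennreal (- (?i x * d x)) \<partial>lborel)"
      by (subst (asm) real_lebesgue_integral_def) auto
    \<comment> \<open>\<open>enn2real\<close> sends infinity to 0, so equality of the real values
      lifts to \<open>ennreal\<close> only because both integrals are finite.\<close>
    then have "(\<integral>\<^sup>+x. ennreal (?i x * d x) \<partial>lborel) = (\<integral>\<^sup>+x. ennreal (- (?i x * d x)) \<partial>lborel)"
      using fin_id by (metis ennreal_enn2real)
    moreover have "ennreal (?i x * t) = ennreal t * indicator (box a b) x" for x t
      by (auto simp: indicator_def)
    moreover have "ennreal (- (?i x * t)) = ennreal (- t) * indicator (box a b) x" for x t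
      by (auto simp: indicator_def)
    ultimately show ?thesis
      by (simp add: emeasure_density)
  qed
  have "density lborel (\<lambda>x. ennreal (d x)) = density lborel (\<lambda>x. ennreal (- d x))"
  proof (rule measure_eqI_generator_eq)
    let ?E = "range (\<lambda>(a, b). box a b :: 'a set)"
    show "Int_stable ?E"
      by (auto simp: Int_stable_def box_Int_box)
    show "?E \<subseteq> Pow UNIV" "sets (density lborel (\<lambda>x. ennreal (d x))) = sigma_sets UNIV ?E"
      "sets (density lborel (\<lambda>x. ennreal (- d x))) = sigma_sets UNIV ?E"
      by (simp_all add: borel_eq_box)
    let ?A = "\<lambda>n::nat. box (- (real n *\<^sub>R One)) (real n *\<^sub>R One) :: 'a set"
    show "range ?A \<subseteq> ?E" "(\<Union>i. ?A i) = UNIV"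
      unfolding UN_box_eq_UNIV by auto
    show "emeasure (density lborel (\<lambda>x. ennreal (d x))) (?A i) \<noteq> \<infinity>" for i
    proof -
      have "emeasure (density lborel (\<lambda>x. ennreal (d x))) (?A i) \<le> (\<integral>\<^sup>+x. ennreal (d x) \<partial>lborel)"
        by (subst emeasure_density) (auto intro!: nn_integral_mono simp: indicator_def)
      then show ?thesis
        using fin(1) by (auto simp: top_unique)
    qed
  qed (use box in auto)
  \<comment> \<open>\<open>ennreal\<close> truncates negative reals to 0, so this equation says that
    the positive and negative parts of \<open>d x\<close> coincide. One of them is always 0, hence
    both are.\<close>
  then have "AE x in lborel. ennreal (d x) = ennreal (- d x)"
    using fin(1) by (subst (asm) finite_density_unique) auto
  then show ?thesis
  proof eventually_elim
    case (elim x)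
    then have "d x = 0"
      by (metis ennreal_eq_0_iff linorder_linear neg_le_0_iff_le neg_0_le_iff_le order_antisym)
    then show ?case by (simp add: d_def)
  qed
qed

section \<open>Integrable functions, almost everywhere equality and shifts\<close>

lemma L1_measurable: "f \<in> L1 \<Longrightarrow> f \<in> borel_measurable borel"
  by (auto simp: L1_def)

lemma L1_iff: "f \<in> L1 \<longleftrightarrow> f \<in> borel_measurable borel \<and> L1_norm f < \<infinity>"
  by (simp add: L1_def L1_norm_def integrable_iff_bounded)

lemma L1_diff: "f \<in> L1 \<Longrightarrow> g \<in> L1 \<Longrightarrow> (\<lambda>x. f x - g x) \<in> L1"
  by (simp add: L1_def)

lemma AE_eq_sym: "f \<doteq> g \<Longrightarrow> g \<doteq> f"
  unfolding AE_eq_def by auto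

lemma L1_converges_cong:
  assumes "L1_converges F f" "\<And>n. F n \<doteq> G n" "f \<doteq> g"
  shows "L1_converges G g"
proof -
  have "L1_norm (\<lambda>x. F n x - f x) = L1_norm (\<lambda>x. G n x - g x)" for n
    using assms(2)[of n] assms(3) unfolding L1_norm_def AE_eq_def
    by (intro nn_integral_cong_AE) auto
  then show ?thesis
    using assms(1) by (simp add: L1_converges_def)
qed

lemma shift_in_L1: "f \<in> L1 \<Longrightarrow> shift v f \<in> L1"
  unfolding L1_def shift_def by (simp add: integrable_lborel_translate)

text \<open>Continuity of translations in \<open>L\<^sup>1\<close>, in the weak form of closedness under limits: testing
  against indicators of boxes moves the shift onto the box, whose boundary is null.\<close>

lemma shift_L1_limit:
  fixes f g :: "'d::finite field"
  assumes fs: "\<And>n. fs n \<in> L1" and f: "f \<in> L1" and g: "g \<in> L1"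
    and lim: "L1_converges fs f" and w: "ws \<longlonglongrightarrow> w"
    and slim: "L1_converges (\<lambda>n. shift (ws n) (fs n)) g"
  shows "g \<doteq> shift w f"
proof -
  note [measurable] = L1_measurable[OF fs] L1_measurable[OF f] L1_measurable[OF g]
  have ind: "integrable lborel (\<lambda>x. indicator B (x - v) * h x)"
    if [measurable]: "B \<in> sets borel" and h: "h \<in> L1"
    for B and v :: "real^'d" and h :: "'d field"
  proof -
    have "integrable lborel h"
      using h by (simp add: L1_def)
    then show ?thesis
      by (rule Bochner_Integration.integrable_bound)
        (use L1_measurable[OF h] in \<open>auto simp: indicator_def\<close>)
  qed
  \<comment> \<open>Testing against a translated indicator is 1-Lipschitz for the L^1 norm, with a
    constant independent of the translation \<open>v\<close>.\<close>
  have ind_bound: "ennreal \<bar>(\<integral>x. indicator B (x - v) * h x \<partial>lborel) - (\<integral>x. indicator B (x - v) * k x \<partial>lborel)\<bar>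
      \<le> L1_norm (\<lambda>x. h x - k x)"
    if B: "B \<in> sets borel" and h: "h \<in> L1" and k: "k \<in> L1"
    for B and v :: "real^'d" and h k :: "'d field"
  proof -
    have i: "integrable lborel (\<lambda>x. indicator B (x - v) * h x - indicator B (x - v) * k x)"
      using ind[OF B] h k by simp
    have "ennreal \<bar>(\<integral>x. indicator B (x - v) * h x \<partial>lborel) - (\<integral>x. indicator B (x - v) * k x \<partial>lborel)\<bar>
      = ennreal (norm (\<integral>x. indicator B (x - v) * h x - indicator B (x - v) * k x \<partial>lborel))"
      using ind[OF B] h k by simp
    also have "\<dots> \<le> (\<integral>\<^sup>+x. norm (indicator B (x - v) * h x - indicator B (x - v) * k x) \<partial>lborel)"
      by (rule integral_norm_bound_ennreal[OF i])
    also have "\<dots> \<le> L1_norm (\<lambda>x. h x - k x)"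
      unfolding L1_norm_def by (intro nn_integral_mono) (auto simp: indicator_def)
    finally show ?thesis .
  qed
  have to_real: "X \<longlonglongrightarrow> (l::real)" if "\<And>n. ennreal \<bar>X n - l\<bar> \<le> Y n" "Y \<longlonglongrightarrow> 0" for X l Y
  proof -
    have "(\<lambda>n. ennreal \<bar>X n - l\<bar>) \<longlonglongrightarrow> ennreal 0"
      by (rule tendsto_sandwich[OF _ _ tendsto_const \<open>Y \<longlonglongrightarrow> 0\<close>[unfolded ennreal_0[symmetric]]])
        (use that in auto)
    then have "(\<lambda>n. \<bar>X n - l\<bar>) \<longlonglongrightarrow> 0"
      by (subst (asm) tendsto_ennreal_iff) auto
    then show ?thesis
      by (simp add: LIM_zero_iff tendsto_rabs_zero_iff)
  qed
  have "(\<integral>x. indicator (box a b) x * g x \<partial>lborel) =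
      (\<integral>x. indicator (box a b) x * shift w f x \<partial>lborel)" for a b :: "real^'d"
  proof -
    let ?i = "indicator (box a b) :: real^'d \<Rightarrow> real"
    let ?J = "\<lambda>n. \<integral>x. ?i (x - ws n) * fs n x \<partial>lborel"
    have mv: "(\<integral>x. ?i (x - v) * h x \<partial>lborel) = (\<integral>x. ?i x * shift v h x \<partial>lborel)"
      if "h \<in> L1" for v h
      using integral_lborel_translate[of "\<lambda>x. ?i (x - v) * h x" v] L1_measurable[OF that]
      by (simp add: shift_def)
    have 1: "?J \<longlonglongrightarrow> (\<integral>x. ?i x * g x \<partial>lborel)"
    proof (rule to_real)
      show "(\<lambda>n. L1_norm (\<lambda>x. shift (ws n) (fs n) x - g x)) \<longlonglongrightarrow> 0"
        using slim by (simp add: L1_converges_def)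
      show "ennreal \<bar>?J n - (\<integral>x. ?i x * g x \<partial>lborel)\<bar> \<le> L1_norm (\<lambda>x. shift (ws n) (fs n) x - g x)" for n
        using ind_bound[of "box a b" "shift (ws n) (fs n)" g 0] shift_in_L1[OF fs] g mv[OF fs]
        by simp
    qed
    \<comment> \<open>Uniformity of \<open>ind_bound\<close> in the translation allows
      \<open>ws n\<close> to vary with \<open>n\<close> while \<open>fs n\<close> is replaced by
      \<open>f\<close>.\<close>
    have 2: "(\<lambda>n. ?J n - (\<integral>x. ?i (x - ws n) * f x \<partial>lborel)) \<longlonglongrightarrow> 0"
    proof (rule to_real)
      show "(\<lambda>n. L1_norm (\<lambda>x. fs n x - f x)) \<longlonglongrightarrow> 0"
        using lim by (simp add: L1_converges_def)
      show "ennreal \<bar>?J n - (\<integral>x. ?i (x - ws n) * f x \<partial>lborel) - 0\<bar> \<le> L1_norm (\<lambda>x. fs n x - f x)" for n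
        using ind_bound[of "box a b" "fs n" f "ws n"] fs f by simp
    qed
    have 3: "(\<lambda>n. \<integral>x. ?i (x - ws n) * f x \<partial>lborel) \<longlonglongrightarrow> (\<integral>x. ?i (x - w) * f x \<partial>lborel)"
    proof (rule integral_dominated_convergence[where w = "\<lambda>x. \<bar>f x\<bar>"])
      show "integrable lborel (\<lambda>x. \<bar>f x\<bar>)"
        using f by (simp add: L1_def)
      \<comment> \<open>Off the frontier, \<open>x - w\<close> lies in the open box or in the open
        complement of the closed box. In either case the indicator is eventually constant along
        \<open>x - ws n\<close>.\<close>
      have "negligible (cbox a b - box a b)"
        by (rule negligible_frontier_interval)
      then have "cbox a b - box a b \<in> null_sets lborel"
        by (simp add: negligible_iff_null_sets null_sets_completion_iff)
      then have "AE x in lborel. x \<notin> cbox a b - box a b"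
        by (rule AE_not_in)
      then have "AE x in lborel. x - w \<notin> cbox a b - box a b"
        by (drule_tac AE_lborel_translate[where v = "- w"]) simp
      then show "AE x in lborel. (\<lambda>n. ?i (x - ws n) * f x) \<longlonglongrightarrow> ?i (x - w) * f x"
      proof eventually_elim
        case (elim x)
        have l: "(\<lambda>n. x - ws n) \<longlonglongrightarrow> x - w"
          using w by (intro tendsto_intros)
        have "\<forall>\<^sub>F n in sequentially. ?i (x - ws n) * f x = ?i (x - w) * f x"
        proof (cases "x - w \<in> box a b")
          case True
          have "\<forall>\<^sub>F n in sequentially. x - ws n \<in> box a b"
            by (rule topological_tendstoD[OF l open_box True])
          then show ?thesis
            by eventually_elim (use True in simp)
        next
          case False
          then have "\<forall>\<^sub>F n in sequentially. x - ws n \<in> - cbox a b"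
            using elim by (intro topological_tendstoD[OF l]) (auto simp: open_Compl closed_cbox)
          then show ?thesis
            by eventually_elim (use False box_subset_cbox[of a b] in \<open>auto simp: indicator_def\<close>)
        qed
        then show ?case
          by (rule tendsto_eventually)
      qed
    qed (auto simp: indicator_def)
    have "?J \<longlonglongrightarrow> (\<integral>x. ?i (x - w) * f x \<partial>lborel)"
      using tendsto_add[OF 2 3] by simp
    with 1 have "(\<integral>x. ?i x * g x \<partial>lborel) = (\<integral>x. ?i (x - w) * f x \<partial>lborel)"
      by (rule LIMSEQ_unique)
    then show ?thesis
      using mv[OF f] by simp
  qed
  then show ?thesis
    unfolding AE_eq_def using g shift_in_L1[OF f, of w]
    by (intro AE_eq_if_box_integrals_eq) (auto simp: L1_def)
qed

section \<open>Kernels and convolution estimates\<close>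

text \<open>A function that is not integrable has Bochner integral 0 by convention, so the
  normalisation to 1 forces integrability.\<close>

lemma kernel_in_L1: "\<kappa> \<in> kernels \<Longrightarrow> \<kappa> \<in> L1"
  unfolding kernels_def L1_def
  using not_integrable_integral_eq[of lborel \<kappa>] by auto

lemma kernel_bounded:
  assumes "\<kappa> \<in> kernels"
  obtains M where "M \<ge> 0" "AE x in lborel. \<bar>\<kappa> x\<bar> \<le> M"
proof
  have fin: "Linf_norm \<kappa> < \<infinity>"
    using assms by (simp add: kernels_def)
  show "enn2real (Linf_norm \<kappa>) \<ge> 0"
    by simp
  have "AE x in lborel. ennreal \<bar>\<kappa> x\<bar> \<le> Linf_norm \<kappa>"
    unfolding Linf_norm_def by (rule esssup_AE)
  then show "AE x in lborel. \<bar>\<kappa> x\<bar> \<le> enn2real (Linf_norm \<kappa>)"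
  proof eventually_elim
    case (elim x)
    then show ?case
      using fin enn2real_mono[OF elim] by simp
  qed
qed

lemma integrable_conv_bounded_kernel:
  assumes k: "\<kappa> \<in> borel_measurable borel" "AE x in lborel. \<bar>\<kappa> x\<bar> \<le> M" and f: "f \<in> L1"
  shows "integrable lborel (\<lambda>y. \<kappa> y * f (x - y))"
proof (rule Bochner_Integration.integrable_bound)
  note [measurable] = k(1) L1_measurable[OF f]
  show "integrable lborel (\<lambda>y. M * f (x - y))"
    using f integrable_lborel_reflect[of f] by (simp add: L1_def)
  show "(\<lambda>y. \<kappa> y * f (x - y)) \<in> borel_measurable lborel"
    by simp
  show "AE y in lborel. norm (\<kappa> y * f (x - y)) \<le> norm (M * f (x - y))"
    using k(2) by eventually_elim (auto simp: abs_mult intro!: mult_right_mono)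
qed

text \<open>Young's inequality with the kernel in L^\<infinity> and the configuration in L^1. The
  constant depends on the kernel only through its essential bound, which is how the bound on the
  norms of \<open>\<kappa>s n\<close> enters part (b).\<close>

lemma conv_diff_le_config:
  assumes k: "\<kappa> \<in> borel_measurable borel" "AE x in lborel. \<bar>\<kappa> x\<bar> \<le> M" "M \<ge> 0"
    and f: "f \<in> L1" and g: "g \<in> L1"
  shows "ennreal \<bar>conv \<kappa> f x - conv \<kappa> g x\<bar> \<le> ennreal M * L1_norm (\<lambda>y. f y - g y)"
proof -
  note [measurable] = L1_measurable[OF f] L1_measurable[OF g]
  note i = integrable_conv_bounded_kernel[OF k(1,2)]
  let ?h = "\<lambda>y. f y - g y"
  have "\<bar>conv \<kappa> f x - conv \<kappa> g x\<bar> = norm (\<integral>y. \<kappa> y * ?h (x - y) \<partial>lborel)"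
    unfolding conv_def by (subst Bochner_Integration.integral_diff[symmetric])
      (auto simp: i f g algebra_simps)
  also have "ennreal \<dots> \<le> (\<integral>\<^sup>+y. ennreal (norm (\<kappa> y * ?h (x - y))) \<partial>lborel)"
    by (rule integral_norm_bound_ennreal) (rule i[OF L1_diff[OF f g]])
  also have "\<dots> \<le> (\<integral>\<^sup>+y. ennreal M * ennreal \<bar>?h (x - y)\<bar> \<partial>lborel)"
    using k(2)
    by (intro nn_integral_mono_AE, eventually_elim)
      (auto simp: abs_mult k(3) simp flip: ennreal_mult intro!: mult_right_mono)
  also have "\<dots> = ennreal M * (\<integral>\<^sup>+y. ennreal \<bar>?h (x - y)\<bar> \<partial>lborel)"
    by (rule nn_integral_cmult) simp
  also have "\<dots> = ennreal M * L1_norm ?h"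
    unfolding L1_norm_def
    by (subst nn_integral_lborel_reflect[where h = "\<lambda>y. ennreal \<bar>?h y\<bar>"]) auto
  finally show ?thesis .
qed

text \<open>The opposite case of Young's inequality: the configuration is bounded by 1, so the L^1
  distance of the kernels controls the error uniformly in \<open>x\<close>. With a fixed
  configuration, as in part (a), this estimate suffices.\<close>

lemma conv_diff_le_kernel:
  assumes k: "\<kappa> \<in> L1" "\<kappa>' \<in> L1" and a: "a \<in> configs"
  shows "ennreal \<bar>conv \<kappa>' a x - conv \<kappa> a x\<bar> \<le> L1_norm (\<lambda>y. \<kappa>' y - \<kappa> y)"
proof -
  have [measurable]: "a \<in> borel_measurable borel" and a01: "\<And>y. a y = 0 \<or> a y = 1"
    using a by (auto simp: configs_def)
  have i: "integrable lborel (\<lambda>y. u y * a (x - y))" if "u \<in> L1" for u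
  proof -
    have "integrable lborel u"
      using that by (simp add: L1_def)
    then show ?thesis
    proof (rule Bochner_Integration.integrable_bound)
      show "AE y in lborel. norm (u y * a (x - y)) \<le> norm (u y)"
      proof (rule AE_I2)
        show "norm (u y * a (x - y)) \<le> norm (u y)" for y
          using a01[of "x - y"] by auto
      qed
    qed (use L1_measurable[OF that] in simp)
  qed
  have "\<bar>conv \<kappa>' a x - conv \<kappa> a x\<bar> = norm (\<integral>y. (\<kappa>' y - \<kappa> y) * a (x - y) \<partial>lborel)"
    unfolding conv_def by (subst Bochner_Integration.integral_diff[symmetric])
      (auto simp: i k algebra_simps)
  also have "ennreal \<dots> \<le> (\<integral>\<^sup>+y. ennreal (norm ((\<kappa>' y - \<kappa> y) * a (x - y))) \<partial>lborel)"
    by (rule integral_norm_bound_ennreal) (rule i[OF L1_diff[OF k(2,1)]])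
  also have "\<dots> \<le> L1_norm (\<lambda>y. \<kappa>' y - \<kappa> y)"
    unfolding L1_norm_def
  proof (rule nn_integral_mono)
    show "ennreal (norm ((\<kappa>' y - \<kappa> y) * a (x - y))) \<le> ennreal \<bar>\<kappa>' y - \<kappa> y\<bar>" for y
      using a01[of "x - y"] by auto
  qed
  finally show ?thesis .
qed

lemma conv_measurable:
  assumes [measurable]: "\<kappa> \<in> borel_measurable borel" "f \<in> borel_measurable borel"
  shows "conv \<kappa> f \<in> borel_measurable borel"
proof -
  have "(\<lambda>x. \<integral>y. \<kappa> y * f (x - y) \<partial>lborel) \<in> borel_measurable lborel"
    by (rule lborel.borel_measurable_lebesgue_integral) simp
  then show ?thesis
    by (simp add: conv_def[abs_def])
qed

text \<open>Young's inequality for L^1 with L^1: after exchanging the integrals by Tonelli, the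
  inner one is a translate of \<open>f\<close> and contributes \<open>L1_norm f\<close> for every
  \<open>y\<close>.\<close>

lemma conv_in_L1:
  assumes k: "\<kappa> \<in> kernels" and f: "f \<in> L1"
  shows "conv \<kappa> f \<in> L1"
proof -
  note kL = kernel_in_L1[OF k]
  note [measurable] = L1_measurable[OF f] L1_measurable[OF kL]
  obtain M where M: "AE x in lborel. \<bar>\<kappa> x\<bar> \<le> M"
    using kernel_bounded[OF k] by blast
  have "L1_norm (conv \<kappa> f) \<le> (\<integral>\<^sup>+x. (\<integral>\<^sup>+y. ennreal \<bar>\<kappa> y\<bar> * ennreal \<bar>f (x - y)\<bar> \<partial>lborel) \<partial>lborel)"
    unfolding L1_norm_def
  proof (rule nn_integral_mono)
    fix x
    have "ennreal (norm (conv \<kappa> f x)) \<le> (\<integral>\<^sup>+y. ennreal (norm (\<kappa> y * f (x - y))) \<partial>lborel)"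
      unfolding conv_def
      by (rule integral_norm_bound_ennreal)
        (rule integrable_conv_bounded_kernel[OF L1_measurable[OF kL] M f])
    then show "ennreal \<bar>conv \<kappa> f x\<bar> \<le> (\<integral>\<^sup>+y. ennreal \<bar>\<kappa> y\<bar> * ennreal \<bar>f (x - y)\<bar> \<partial>lborel)"
      by (simp add: abs_mult ennreal_mult)
  qed
  also have "\<dots> = (\<integral>\<^sup>+y. (\<integral>\<^sup>+x. ennreal \<bar>\<kappa> y\<bar> * ennreal \<bar>f (x - y)\<bar> \<partial>lborel) \<partial>lborel)"
    by (rule lborel_pair.Fubini') simp
  also have "\<dots> = (\<integral>\<^sup>+y. ennreal \<bar>\<kappa> y\<bar> * L1_norm f \<partial>lborel)"
  proof (rule nn_integral_cong)
    fix y
    have "(\<integral>\<^sup>+x. ennreal \<bar>f (x - y)\<bar> \<partial>lborel) = L1_norm f"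
      using nn_integral_lborel_translate[of "\<lambda>x. ennreal \<bar>f x\<bar>" "- y"] by (simp add: L1_norm_def)
    then show "(\<integral>\<^sup>+x. ennreal \<bar>\<kappa> y\<bar> * ennreal \<bar>f (x - y)\<bar> \<partial>lborel) = ennreal \<bar>\<kappa> y\<bar> * L1_norm f"
      by (simp add: nn_integral_cmult)
  qed
  also have "\<dots> = L1_norm \<kappa> * L1_norm f"
    unfolding L1_norm_def[of \<kappa>] by (rule nn_integral_multc) simp
  also have "\<dots> < \<infinity>"
    using kL f by (simp add: L1_iff ennreal_mult_less_top)
  finally show ?thesis
    using conv_measurable[of \<kappa> f] by (simp add: L1_iff)
qed

text \<open>The equality holds at every point, since for each \<open>x\<close> the functions
  \<open>y \<mapsto> f (x - y)\<close> and \<open>y \<mapsto> g (x - y)\<close> differ only on a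
  reflected null set. The threshold indicators of the automaton therefore do not see the choice of
  representative.\<close>

lemma conv_cong_AE:
  assumes [measurable]: "\<kappa> \<in> borel_measurable borel" "f \<in> borel_measurable borel" "g \<in> borel_measurable borel"
    and "f \<doteq> g"
  shows "conv \<kappa> f = conv \<kappa> g"
proof
  fix x
  have "AE y in lborel. f (x - y) = g (x - y)"
    using assms(4) unfolding AE_eq_def by (rule AE_lborel_reflect)
  then show "conv \<kappa> f x = conv \<kappa> g x"
    unfolding conv_def by (intro integral_cong_AE) auto
qed

section \<open>Shifts, representatives and integrability for the automaton\<close>

lemma conv_shift: "conv \<kappa> (shift v f) = shift v (conv \<kappa> f)"
  by (auto simp: conv_def shift_def algebra_simps)

lemma RealLife_shift: "RealLife (s0, b0, b1, s1) \<kappa> (shift v f) = shift v (RealLife (s0, b0, b1, s1) \<kappa> f)"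
  by (simp add: conv_shift) (simp add: shift_def)

lemma RealLife_cong_AE:
  assumes "\<kappa> \<in> borel_measurable borel" "f \<in> borel_measurable borel" "g \<in> borel_measurable borel"
    and "f \<doteq> g"
  shows "RealLife (s0, b0, b1, s1) \<kappa> f \<doteq> RealLife (s0, b0, b1, s1) \<kappa> g"
  using assms(4) conv_cong_AE[OF assms] unfolding AE_eq_def by auto

text \<open>Markov's inequality: the indicator is at most
  \<open>\<bar>c x\<bar> / l\<close>.\<close>

lemma nn_integral_indicator_ge_finite:
  assumes c: "c \<in> L1" and l: "0 < l"
  shows "(\<integral>\<^sup>+x. indicator {l..} (c x) \<partial>lborel) < \<infinity>"
proof -
  note [measurable] = L1_measurable[OF c]
  have "(\<integral>\<^sup>+x. indicator {l..} (c x) \<partial>lborel) \<le> (\<integral>\<^sup>+x. ennreal (1 / l) * ennreal \<bar>c x\<bar> \<partial>lborel)"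
    using l by (intro nn_integral_mono)
      (auto simp: indicator_def field_simps simp flip: ennreal_mult ennreal_1)
  also have "\<dots> = ennreal (1 / l) * L1_norm c"
    unfolding L1_norm_def by (rule nn_integral_cmult) simp
  also have "\<dots> < \<infinity>"
    using c by (simp add: L1_iff ennreal_mult_less_top)
  finally show ?thesis .
qed

text \<open>The survival term and the part of the birth term containing \<open>f\<close> are each at
  most \<open>\<bar>f x\<bar>\<close>. What remains is the birth indicator, supported where the
  convolution is at least \<open>b0 > 0\<close>, a set of finite measure.\<close>

lemma RealLife_in_L1:
  assumes k: "\<kappa> \<in> kernels" and f: "f \<in> L1" and b0: "0 < b0"
  shows "RealLife (s0, b0, b1, s1) \<kappa> f \<in> L1"
proof -
  have c: "conv \<kappa> f \<in> L1"
    by (rule conv_in_L1[OF k f])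
  note [measurable] = L1_measurable[OF f] L1_measurable[OF c]
  have "(\<integral>\<^sup>+x. ennreal \<bar>RealLife (s0, b0, b1, s1) \<kappa> f x\<bar> \<partial>lborel)
      \<le> (\<integral>\<^sup>+x. 2 * ennreal \<bar>f x\<bar> + indicator {b0..} (conv \<kappa> f x) \<partial>lborel)"
    by (intro nn_integral_mono)
      (auto simp: indicator_def simp flip: ennreal_mult ennreal_plus ennreal_1 ennreal_numeral)
  also have "\<dots> = 2 * L1_norm f + (\<integral>\<^sup>+x. indicator {b0..} (conv \<kappa> f x) \<partial>lborel)"
    unfolding L1_norm_def by (simp add: nn_integral_add nn_integral_cmult)
  also have "\<dots> < \<infinity>"
    using f nn_integral_indicator_ge_finite[OF c b0] by (simp add: L1_iff ennreal_mult_less_top)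
  finally show ?thesis
    by (simp add: L1_iff L1_norm_def)
qed

section \<open>Convergence of the automata along convergent sequences\<close>

lemma indicator_interval_L1_tendsto:
  fixes c :: "'d::finite field" and l u :: real
  assumes c: "c \<in> L1" and cs: "\<And>n. cs n \<in> borel_measurable borel"
    and unif: "\<And>n x. ennreal \<bar>cs n x - c x\<bar> \<le> e n" "e \<longlonglongrightarrow> 0"
    and l: "0 < l" and bdry: "AE x in lborel. c x \<noteq> l \<and> c x \<noteq> u"
  shows "(\<lambda>n. \<integral>\<^sup>+x. ennreal \<bar>indicator {l..u} (cs n x) - indicator {l..u} (c x)\<bar> \<partial>lborel) \<longlonglongrightarrow> 0"
proof -
  note [measurable] = L1_measurable[OF c] cs
  let ?h = "\<lambda>n x. ennreal \<bar>indicator {l..u} (cs n x) - indicator {l..u} (c x)\<bar>"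
  \<comment> \<open>Once the error is below \<open>l / 2\<close>, \<open>cs n x \<ge> l\<close>
    implies \<open>c x > l / 2\<close>. So beyond \<open>N\<close> both indicators vanish outside
    the set where \<open>c x \<ge> l / 2\<close>, and dominated convergence is applied to the
    sequence started at \<open>N\<close>.\<close>
  have "\<forall>\<^sub>F n in sequentially. e n < ennreal (l / 2)"
    using unif(2) l by (intro order_tendstoD) auto
  then obtain N where N: "\<And>n. n \<ge> N \<Longrightarrow> e n < ennreal (l / 2)"
    by (auto simp: eventually_sequentially)
  have close: "\<bar>cs n x - c x\<bar> < l / 2" if "n \<ge> N" for n x
    using le_less_trans[OF unif(1)[of n x] N[OF that]] by (simp add: ennreal_less_iff)
  have lim: "(\<lambda>n. cs n x) \<longlonglongrightarrow> c x" for x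
  proof -
    have "(\<lambda>n. ennreal \<bar>cs n x - c x\<bar>) \<longlonglongrightarrow> ennreal 0"
      by (rule tendsto_sandwich[OF _ _ tendsto_const unif(2)[unfolded ennreal_0[symmetric]]])
        (use unif(1) in auto)
    then have "(\<lambda>n. \<bar>cs n x - c x\<bar>) \<longlonglongrightarrow> 0"
      by (subst (asm) tendsto_ennreal_iff) auto
    then show ?thesis
      by (simp add: LIM_zero_iff tendsto_rabs_zero_iff)
  qed
  have "(\<lambda>n. \<integral>\<^sup>+x. ?h (n + N) x \<partial>lborel) \<longlonglongrightarrow> (\<integral>\<^sup>+x. 0 \<partial>(lborel :: (real^'d) measure))"
  proof (rule nn_integral_dominated_convergence[where w = "\<lambda>x. indicator {l/2..} (c x)"])
    show "AE x in lborel. ?h (n + N) x \<le> indicator {l/2..} (c x)" for n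
    proof (rule AE_I2)
      show "?h (n + N) x \<le> indicator {l/2..} (c x)" for x
        using close[of "n + N" x] l by (auto simp: indicator_def)
    qed
    show "(\<integral>\<^sup>+x. indicator {l/2..} (c x) \<partial>lborel) < \<infinity>"
      using l by (intro nn_integral_indicator_ge_finite[OF c]) auto
    show "AE x in lborel. (\<lambda>n. ?h (n + N) x) \<longlonglongrightarrow> 0"
      using bdry
    proof eventually_elim
      case (elim x)
      have "\<forall>\<^sub>F n in sequentially. ?h n x = 0"
      proof -
        consider "c x < l" | "c x > u" | "l < c x" "c x < u"
          using elim by linarith
        then show ?thesis
        proof cases
          case 1
          then show ?thesis
            using order_tendstoD(2)[OF lim 1] by (auto elim!: eventually_mono)
        next
          case 2
          then show ?thesis
            using order_tendstoD(1)[OF lim 2] by (auto elim!: eventually_mono)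
        next
          case 3
          have "\<forall>\<^sub>F n in sequentially. l < cs n x \<and> cs n x < u"
            using order_tendstoD(1)[OF lim 3(1)] order_tendstoD(2)[OF lim 3(2)]
            by (rule eventually_conj)
          then show ?thesis
            by eventually_elim (use 3 in auto)
        qed
      qed
      then have "(\<lambda>n. ?h n x) \<longlonglongrightarrow> 0"
        by (rule tendsto_eventually)
      then show ?case
        by (rule LIMSEQ_ignore_initial_segment)
    qed
  qed auto
  then show ?thesis
    \<comment> \<open>The limit is 0 times the infinite measure of the whole space, and this product
      is 0 in \<open>ennreal\<close>.\<close>
    by (subst (asm) nn_integral_const) (rule LIMSEQ_offset[where k = N], simp)
qed

text \<open>The uniform error \<open>e\<close> is kept abstract to serve both parts: for a fixed
  configuration it is the L^1 distance of the kernels, and for moving configurations a second term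
  is added.\<close>

lemma RealLife_converges:
  fixes a :: "'d::finite field"
  assumes \<theta>: "(s0, b0, b1, s1) \<in> Theta" and k: "\<kappa> \<in> kernels" and ks: "\<And>n. \<kappa>s n \<in> kernels"
    and a: "a \<in> configs0 (s0, b0, b1, s1) \<kappa>"
    and as: "\<And>n. as n \<in> L1" "L1_converges as a"
    and unif: "\<And>n x. ennreal \<bar>conv (\<kappa>s n) (as n) x - conv \<kappa> a x\<bar> \<le> e n" "e \<longlonglongrightarrow> 0"
  shows "L1_converges (\<lambda>n. RealLife (s0, b0, b1, s1) (\<kappa>s n) (as n)) (RealLife (s0, b0, b1, s1) \<kappa> a)"
proof -
  have aL: "a \<in> L1" and a01: "\<And>x. a x = 0 \<or> a x = 1"
    using a by (auto simp: configs1_def configs_def)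
  have c: "conv \<kappa> a \<in> L1" and cs: "\<And>n. conv (\<kappa>s n) (as n) \<in> borel_measurable borel"
    using conv_in_L1[OF k aL] conv_in_L1[OF ks as(1)] L1_measurable by blast+
  note [measurable] = L1_measurable[OF aL] L1_measurable[OF as(1)] L1_measurable[OF c] cs
  have "{x. conv \<kappa> a x \<in> {s0, b0, b1, s1}} \<in> null_sets lborel"
    using a by simp
  then have bdry: "AE x in lborel. conv \<kappa> a x \<notin> {s0, b0, b1, s1}"
    by (drule_tac AE_not_in) simp
  let ?d = "\<lambda>l u n x. ennreal \<bar>indicator {l..u} (conv (\<kappa>s n) (as n) x) - indicator {l..u} (conv \<kappa> a x)\<bar>"
  have S: "(\<lambda>n. \<integral>\<^sup>+x. ?d s0 s1 n x \<partial>lborel) \<longlonglongrightarrow> 0"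
    using \<theta> bdry by (intro indicator_interval_L1_tendsto[OF c cs unif]) (auto simp: Theta_def)
  have B: "(\<lambda>n. \<integral>\<^sup>+x. ?d b0 b1 n x \<partial>lborel) \<longlonglongrightarrow> 0"
    using \<theta> bdry by (intro indicator_interval_L1_tendsto[OF c cs unif]) (auto simp: Theta_def)
  have A: "(\<lambda>n. 2 * L1_norm (\<lambda>x. as n x - a x)) \<longlonglongrightarrow> 2 * 0"
    using as(2) unfolding L1_converges_def by (intro ennreal_tendsto_cmult) auto
  have "(\<lambda>n. 2 * L1_norm (\<lambda>x. as n x - a x) +
      ((\<integral>\<^sup>+x. ?d s0 s1 n x \<partial>lborel) + (\<integral>\<^sup>+x. ?d b0 b1 n x \<partial>lborel))) \<longlonglongrightarrow> 2 * 0 + (0 + 0)"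
    by (intro tendsto_add A S B)
  then have lim: "(\<lambda>n. 2 * L1_norm (\<lambda>x. as n x - a x) +
      ((\<integral>\<^sup>+x. ?d s0 s1 n x \<partial>lborel) + (\<integral>\<^sup>+x. ?d b0 b1 n x \<partial>lborel))) \<longlonglongrightarrow> 0"
    by simp
  \<comment> \<open>The difference splits into a change from \<open>u\<close> to \<open>t\<close>
    with the new indicators and a change of indicators at \<open>u\<close>. As \<open>u\<close> is 0
    or 1, the second piece selects one of the two indicator differences. The value \<open>t\<close>
    is any real, because \<open>as n\<close> is only an integrable function.\<close>
  have switch: "\<bar>(t * p' + (1 - t) * q') - (u * p + (1 - u) * q)\<bar> \<le>
      2 * \<bar>t - u\<bar> + (\<bar>p' - p\<bar> + \<bar>q' - q\<bar>)"
    if "u = 0 \<or> u = 1" "p = 0 \<or> p = 1" "q = 0 \<or> q = 1" "p' = 0 \<or> p' = 1" "q' = 0 \<or> q' = 1"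
    for t u p q p' q' :: real
  proof -
    have "\<bar>(t - u) * (p' - q')\<bar> \<le> 2 * \<bar>t - u\<bar>"
      using that by (auto simp: abs_mult abs_minus_commute)
    moreover have "\<bar>u * (p' - p) + (1 - u) * (q' - q)\<bar> \<le> \<bar>p' - p\<bar> + \<bar>q' - q\<bar>"
      using that(1) by auto
    moreover have "(t * p' + (1 - t) * q') - (u * p + (1 - u) * q) =
        (t - u) * (p' - q') + (u * (p' - p) + (1 - u) * (q' - q))"
      by (simp add: algebra_simps)
    ultimately show ?thesis
      by (simp only: order_trans[OF abs_triangle_ineq add_mono])
  qed
  have bound: "L1_norm (\<lambda>x. RealLife (s0, b0, b1, s1) (\<kappa>s n) (as n) x - RealLife (s0, b0, b1, s1) \<kappa> a x)
      \<le> 2 * L1_norm (\<lambda>x. as n x - a x) +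
      ((\<integral>\<^sup>+x. ?d s0 s1 n x \<partial>lborel) + (\<integral>\<^sup>+x. ?d b0 b1 n x \<partial>lborel))" for n
  proof -
    have "L1_norm (\<lambda>x. RealLife (s0, b0, b1, s1) (\<kappa>s n) (as n) x - RealLife (s0, b0, b1, s1) \<kappa> a x)
      \<le> (\<integral>\<^sup>+x. 2 * ennreal \<bar>as n x - a x\<bar> + (?d s0 s1 n x + ?d b0 b1 n x) \<partial>lborel)"
      unfolding L1_norm_def
    proof (rule nn_integral_mono)
      fix x
      have "\<bar>RealLife (s0, b0, b1, s1) (\<kappa>s n) (as n) x - RealLife (s0, b0, b1, s1) \<kappa> a x\<bar> \<le>
          2 * \<bar>as n x - a x\<bar> +
          (\<bar>indicator {s0..s1} (conv (\<kappa>s n) (as n) x) - indicator {s0..s1} (conv \<kappa> a x)\<bar> +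
           \<bar>indicator {b0..b1} (conv (\<kappa>s n) (as n) x) - indicator {b0..b1} (conv \<kappa> a x)\<bar>)"
        unfolding RealLife.simps
        by (rule switch) (use a01[of x] in \<open>auto simp: indicator_def\<close>)
      then show "ennreal \<bar>RealLife (s0, b0, b1, s1) (\<kappa>s n) (as n) x - RealLife (s0, b0, b1, s1) \<kappa> a x\<bar> \<le>
          2 * ennreal \<bar>as n x - a x\<bar> + (?d s0 s1 n x + ?d b0 b1 n x)"
        by (simp del: RealLife.simps
          flip: ennreal_mult ennreal_plus ennreal_numeral)
    qed
    also have "\<dots> = 2 * L1_norm (\<lambda>x. as n x - a x) +
      ((\<integral>\<^sup>+x. ?d s0 s1 n x \<partial>lborel) + (\<integral>\<^sup>+x. ?d b0 b1 n x \<partial>lborel))"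
      unfolding L1_norm_def by (simp add: nn_integral_add nn_integral_cmult)
    finally show ?thesis .
  qed
  show ?thesis
    unfolding L1_converges_def
    by (rule tendsto_sandwich[OF _ _ tendsto_const lim]) (use bound in auto)
qed

lemma RealLife_converges_same_config:
  assumes "(s0, b0, b1, s1) \<in> Theta" and ks: "\<And>n. \<kappa>s n \<in> kernels" and k: "\<kappa> \<in> kernels"
    and lim: "L1_converges \<kappa>s \<kappa>" and a: "a \<in> configs0 (s0, b0, b1, s1) \<kappa>"
  shows "L1_converges (\<lambda>n. RealLife (s0, b0, b1, s1) (\<kappa>s n) a) (RealLife (s0, b0, b1, s1) \<kappa> a)"
proof (rule RealLife_converges[OF assms(1) k ks a])
  show "a \<in> L1" "L1_converges (\<lambda>n. a) a"
    using a by (auto simp: configs1_def L1_converges_def L1_norm_def)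
  show "ennreal \<bar>conv (\<kappa>s n) a x - conv \<kappa> a x\<bar> \<le> L1_norm (\<lambda>y. \<kappa>s n y - \<kappa> y)" for n x
    using a by (intro conv_diff_le_kernel kernel_in_L1 k ks) (auto simp: configs1_def)
  show "(\<lambda>n. L1_norm (\<lambda>y. \<kappa>s n y - \<kappa> y)) \<longlonglongrightarrow> 0"
    using lim by (simp add: L1_converges_def)
qed

text \<open>The limit \<open>a\<close> is a configuration only up to a null set. The estimates are
  made for a genuine {0,1}-valued representative \<open>g\<close>, and the result is carried back to
  \<open>a\<close> by almost everywhere equality.\<close>

lemma RealLife_converges_bounded_kernels:
  fixes \<kappa> :: "'d::finite field"
  assumes "(s0, b0, b1, s1) \<in> Theta" and ks: "\<And>n. \<kappa>s n \<in> kernels" and k: "\<kappa> \<in> kernels"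
    and lim: "L1_converges \<kappa>s \<kappa>" and bdd: "(SUP n. Linf_norm (\<kappa>s n)) < \<infinity>"
    and a: "a \<in> L1" "class_in a (configs0 (s0, b0, b1, s1) \<kappa>)"
    and as: "\<And>n. as n \<in> L1" "L1_converges as a"
  shows "L1_converges (\<lambda>n. RealLife (s0, b0, b1, s1) (\<kappa>s n) (as n)) (RealLife (s0, b0, b1, s1) \<kappa> a)"
proof -
  note kL = kernel_in_L1[OF k] kernel_in_L1[OF ks]
  obtain g where g: "g \<in> configs0 (s0, b0, b1, s1) \<kappa>" "a \<doteq> g"
    using a(2) by (auto simp: class_in_def)
  then have gL: "g \<in> L1" and g01: "g \<in> configs"
    by (auto simp: configs1_def)
  have asg: "L1_converges as g"
    using L1_converges_cong[OF as(2) _ g(2)] by (simp add: AE_eq_def)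
  obtain M where M: "M \<ge> 0" "ennreal M = (SUP n. Linf_norm (\<kappa>s n))"
    using bdd by (metis ennreal_cases infinity_ennreal_def less_irrefl)
  have kM: "AE x in lborel. \<bar>\<kappa>s n x\<bar> \<le> M" for n
  proof -
    have le: "Linf_norm (\<kappa>s n) \<le> ennreal M"
      unfolding M(2) by (rule SUP_upper) simp
    have "AE x in lborel. ennreal \<bar>\<kappa>s n x\<bar> \<le> Linf_norm (\<kappa>s n)"
      unfolding Linf_norm_def by (rule esssup_AE)
    then show ?thesis
    proof eventually_elim
      case (elim x)
      then have "ennreal \<bar>\<kappa>s n x\<bar> \<le> ennreal M"
        using le by (rule order_trans)
      then show ?case
        using M(1) by simp
    qed
  qed
  let ?e = "\<lambda>n. ennreal M * L1_norm (\<lambda>x. as n x - g x) + L1_norm (\<lambda>x. \<kappa>s n x - \<kappa> x)"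
  have "?e \<longlonglongrightarrow> ennreal M * 0 + 0"
    using asg lim unfolding L1_converges_def by (intro tendsto_add ennreal_tendsto_cmult) auto
  then have e: "?e \<longlonglongrightarrow> 0"
    by simp
  \<comment> \<open>The intermediate term is \<open>conv (\<kappa>s n) g\<close>: first the
    configuration changes under the bounded kernel \<open>\<kappa>s n\<close>, then the kernel
    changes under the {0,1}-valued \<open>g\<close>.\<close>
  have unif: "ennreal \<bar>conv (\<kappa>s n) (as n) x - conv \<kappa> g x\<bar> \<le> ?e n" for n x
  proof -
    have "ennreal \<bar>conv (\<kappa>s n) (as n) x - conv \<kappa> g x\<bar> \<le>
        ennreal (\<bar>conv (\<kappa>s n) (as n) x - conv (\<kappa>s n) g x\<bar> + \<bar>conv (\<kappa>s n) g x - conv \<kappa> g x\<bar>)"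
      by (intro ennreal_leI) linarith
    also have "\<dots> = ennreal \<bar>conv (\<kappa>s n) (as n) x - conv (\<kappa>s n) g x\<bar> +
        ennreal \<bar>conv (\<kappa>s n) g x - conv \<kappa> g x\<bar>"
      by simp
    also have "\<dots> \<le> ?e n"
      by (intro add_mono conv_diff_le_config[OF L1_measurable[OF kL(2)] kM M(1) as(1) gL]
          conv_diff_le_kernel[OF kL g01])
    finally show ?thesis .
  qed
  have "L1_converges (\<lambda>n. RealLife (s0, b0, b1, s1) (\<kappa>s n) (as n)) (RealLife (s0, b0, b1, s1) \<kappa> g)"
    by (rule RealLife_converges[OF assms(1) k ks g(1) as(1) asg unif e])
  moreover have "RealLife (s0, b0, b1, s1) \<kappa> g \<doteq> RealLife (s0, b0, b1, s1) \<kappa> a"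
    by (intro AE_eq_sym[OF RealLife_cong_AE] L1_measurable kL(1) a(1) gL g(2))
  moreover have "f \<doteq> f" for f :: "'d field"
    by (simp add: AE_eq_def)
  ultimately show ?thesis
    by (blast intro: L1_converges_cong)
qed

section \<open>Evolution from joint sequential continuity\<close>

lemma funpow_in_L1:
  fixes \<Phi> :: "'d::finite field \<Rightarrow> 'd field"
  shows "(\<And>f. f \<in> L1 \<Longrightarrow> \<Phi> f \<in> L1) \<Longrightarrow> f \<in> L1 \<Longrightarrow> (\<Phi> ^^ n) f \<in> L1"
  by (induction n) auto

text \<open>Iterating \<open>cont\<close> along the orbit of \<open>a\<close> shows that the
  iterates of \<open>as n\<close> converge to the iterate of \<open>a\<close>. By periodicity up to
  a shift they are also translates of \<open>as n\<close>, and \<open>shift_L1_limit\<close>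
  identifies the limit as a translate of \<open>a\<close>.\<close>

lemma evolves_toI:
  fixes S :: "'d::finite field set"
  assumes "L1_map \<Phi>" "shift_commuting \<Phi>"
    and "\<And>n. L1_map (\<Phi>s n)" "\<And>n. shift_commuting (\<Phi>s n)"
    and "S \<subseteq> L1" "shift_invariant S"
    and cont: "\<And>as a. a \<in> L1 \<Longrightarrow> class_in a S \<Longrightarrow> (\<And>n. as n \<in> L1) \<Longrightarrow> L1_converges as a \<Longrightarrow>
      L1_converges (\<lambda>n. \<Phi>s n (as n)) (\<Phi> a)"
  shows "evolves_to \<Phi>s \<Phi> S"
proof -
  have L: "\<And>f. f \<in> L1 \<Longrightarrow> \<Phi> f \<in> L1" "\<And>n f. f \<in> L1 \<Longrightarrow> \<Phi>s n f \<in> L1"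
    using assms(1,3) by (auto simp: L1_map_def)
  \<comment> \<open>\<open>ws n\<close> is the total displacement after \<open>P\<close> steps. The
    drifting clause takes \<open>real P *\<^sub>R vs n\<close>, the periodic clause takes 0, and the
    fixed point clause is the periodic one with \<open>P = 1\<close>.\<close>
  have limit: "(\<Phi> ^^ P) a \<doteq> shift w a"
    if as: "\<And>n. as n \<in> L1" and a: "a \<in> L1" and lim: "L1_converges as a"
      and orbit: "\<And>p. p < P \<Longrightarrow> class_in ((\<Phi> ^^ p) a) S"
      and w: "ws \<longlonglongrightarrow> w" and per: "\<And>n. (\<Phi>s n ^^ P) (as n) \<doteq> shift (ws n) (as n)"
    for as a P ws w
  proof -
    have it: "\<And>p. (\<Phi> ^^ p) a \<in> L1" "\<And>n p. (\<Phi>s n ^^ p) (as n) \<in> L1"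
      using L a as by (auto intro: funpow_in_L1)
    \<comment> \<open>The step from \<open>p\<close> to \<open>Suc p\<close> applies
      \<open>cont\<close> at the \<open>p\<close>-th iterate with \<open>p < P\<close>, which
      matches the range of the orbit condition.\<close>
    have "p \<le> P \<Longrightarrow> L1_converges (\<lambda>n. (\<Phi>s n ^^ p) (as n)) ((\<Phi> ^^ p) a)" for p
    proof (induction p)
      case 0
      then show ?case using lim by simp
    next
      case (Suc p)
      then show ?case
        using cont[OF it(1) orbit[of p] it(2)] by simp
    qed
    then have "L1_converges (\<lambda>n. (\<Phi>s n ^^ P) (as n)) ((\<Phi> ^^ P) a)"
      by simp
    then have "L1_converges (\<lambda>n. shift (ws n) (as n)) ((\<Phi> ^^ P) a)"
      by (rule L1_converges_cong[OF _ per]) (simp add: AE_eq_def)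
    then show ?thesis
      by (rule shift_L1_limit[OF as a it(1) lim w])
  qed
  have shift0: "shift 0 f = f" for f :: "'d field"
    by (simp add: shift_def)
  show ?thesis
    unfolding evolves_to_def
  proof (intro conjI allI impI)
    fix as :: "nat \<Rightarrow> 'd field" and a :: "'d field"
    assume as: "\<forall>n. as n \<in> L1" and a: "a \<in> L1" and aS: "class_in a S" and lim: "L1_converges as a"
    show "\<Phi> a \<doteq> a" if "\<forall>n. \<Phi>s n (as n) \<doteq> as n"
      using limit[of as a 1 "\<lambda>_. 0" 0] that as a aS lim by (simp add: shift0)
    fix P
    assume orbit: "\<forall>p<P. class_in ((\<Phi> ^^ p) a) S"
    show "(\<Phi> ^^ P) a \<doteq> a" if "\<forall>n. (\<Phi>s n ^^ P) (as n) \<doteq> as n"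
      using limit[of as a P "\<lambda>_. 0" 0] that as a orbit lim by (simp add: shift0)
    fix vs :: "nat \<Rightarrow> real^'d" and v
    assume "vs \<longlonglongrightarrow> v" and "\<forall>n. (\<Phi>s n ^^ P) (as n) \<doteq> shift (real P *\<^sub>R vs n) (as n)"
    then show "(\<Phi> ^^ P) a \<doteq> shift (real P *\<^sub>R v) a"
      using as a orbit lim by (intro limit[of as a P "\<lambda>n. real P *\<^sub>R vs n"] tendsto_intros) auto
  qed (use assms in auto)
qed

section \<open>The standing requirements of evolution, and the conclusion\<close>

lemma RealLife_L1_map:
  assumes "\<kappa> \<in> kernels" "0 < b0"
  shows "L1_map (RealLife (s0, b0, b1, s1) \<kappa>)"
  unfolding L1_map_def
  using RealLife_in_L1[OF assms(1) _ assms(2)]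
    RealLife_cong_AE[OF L1_measurable[OF kernel_in_L1[OF assms(1)]] L1_measurable L1_measurable]
  by blast

lemma RealLife_shift_commuting: "shift_commuting (RealLife (s0, b0, b1, s1) \<kappa>)"
  unfolding shift_commuting_def RealLife_shift by (simp add: AE_eq_def)

lemma configs0_shift_invariant: "shift_invariant (configs0 (s0, b0, b1, s1) \<kappa>)"
  unfolding shift_invariant_def class_in_def
proof (intro allI ballI bexI)
  fix v and f :: "'a field"
  assume f: "f \<in> configs0 (s0, b0, b1, s1) \<kappa>"
  show "shift v f \<doteq> shift v f"
    by (simp add: AE_eq_def)
  have fL: "f \<in> L1"
    using f by (simp add: configs1_def)
  have "AE x in lborel. conv \<kappa> f x \<notin> {s0, b0, b1, s1}"
    using f by (auto dest!: AE_not_in)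
  from AE_lborel_translate[OF this, of v]
  have AE: "AE x in lborel. conv \<kappa> (shift v f) x \<notin> {s0, b0, b1, s1}"
    unfolding conv_shift by (simp only: shift_def)
  \<comment> \<open>The almost everywhere statement alone does not make the exceptional set Borel.
    With \<open>\<kappa>\<close> arbitrary here, measurability is inherited from the original null
    set by taking its preimage under the translation.\<close>
  have "{x. conv \<kappa> f x \<in> {s0, b0, b1, s1}} \<in> sets borel"
    using f by auto
  then have "(\<lambda>x. x + v) -` {x. conv \<kappa> f x \<in> {s0, b0, b1, s1}} \<inter> space borel \<in> sets borel"
    by (intro measurable_sets[of _ borel borel]) auto
  then have "{x. conv \<kappa> (shift v f) x \<in> {s0, b0, b1, s1}} \<in> sets lborel"
    unfolding conv_shift by (simp add: shift_def vimage_def)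
  with AE have "{x. conv \<kappa> (shift v f) x \<in> {s0, b0, b1, s1}} \<in> null_sets lborel"
    by (subst AE_iff_null_sets) auto
  moreover have "shift v f \<in> configs"
    using f L1_measurable[OF fL] unfolding configs0.simps configs1_def configs_def shift_def by auto
  ultimately show "shift v f \<in> configs0 (s0, b0, b1, s1) \<kappa>"
    using shift_in_L1[OF fL] by (simp add: configs1_def)
qed

theorem theorem1p4:
  fixes s0 b0 b1 s1 :: real
    and \<kappa>s :: "nat \<Rightarrow> real ^ 'd::finite \<Rightarrow> real"
    and \<kappa> :: "real ^ 'd \<Rightarrow> real"
  assumes "(s0, b0, b1, s1) \<in> Theta"
    and "\<And>n. \<kappa>s n \<in> kernels"
    and "\<kappa> \<in> kernels"
    and "L1_converges \<kappa>s \<kappa>"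
  shows "(\<forall>a \<in> configs0 (s0, b0, b1, s1) \<kappa>.
            L1_converges (\<lambda>n. RealLife (s0, b0, b1, s1) (\<kappa>s n) a) (RealLife (s0, b0, b1, s1) \<kappa> a)) \<and>
         ((SUP n. Linf_norm (\<kappa>s n)) < \<infinity> \<longrightarrow>
            evolves_to (\<lambda>n. RealLife (s0, b0, b1, s1) (\<kappa>s n)) (RealLife (s0, b0, b1, s1) \<kappa>)
              (configs0 (s0, b0, b1, s1) \<kappa>))"
proof (intro conjI ballI impI)
  show "L1_converges (\<lambda>n. RealLife (s0, b0, b1, s1) (\<kappa>s n) a) (RealLife (s0, b0, b1, s1) \<kappa> a)"
    if "a \<in> configs0 (s0, b0, b1, s1) \<kappa>" for a
    by (rule RealLife_converges_same_config[OF assms that])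
  assume bdd: "(SUP n. Linf_norm (\<kappa>s n)) < \<infinity>"
  have "0 < b0"
    using assms(1) by (auto simp: Theta_def)
  then show "evolves_to (\<lambda>n. RealLife (s0, b0, b1, s1) (\<kappa>s n)) (RealLife (s0, b0, b1, s1) \<kappa>)
      (configs0 (s0, b0, b1, s1) \<kappa>)"
    by (intro evolves_toI RealLife_L1_map RealLife_shift_commuting configs0_shift_invariant
        RealLife_converges_bounded_kernels assms bdd)
      (auto simp: configs1_def)
qed

end
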